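(* Let $\mathbf{k}$ be a commutative ring, $q\in\mathbf{k}$, $n\ge0$ and $I\subseteq[n-1]$. Then \[L^{(q)}_I=\sum_{\substack{J\subseteq I\\ K\subseteq\operatorname{Peak}(I)\\ J\cap K=\emptyset}}(-q)^{|K|}(q-1)^{|J|}\,\eta^{(q)}_{J\cup(K-1)\cup K}.\]
   Context: Let $x_1,x_2,\dots$ be commuting indeterminates, working in $\mathbf{k}[[x_1,x_2,\dots]]$. Let $\mathbb{P}=\{1,2,\dots\}$, $\mathbb{P}^{\pm}=\mathbb{P}\cup(-\mathbb{P})$ totally ordered by $-1<1<-2<2<\cdots$. For $\pi=\pi_1\cdots\pi_n\in S_n$, an enriched $P$-partition for the chain $\pi_1<_\pi\cdots<_\pi\pi_n$ is $f:[n]\to\mathbb{P}^{\pm}$ such that whenever $i<_\pi j$: if $i<j$ then $f(i)<f(j)$ or $f(i)=f(j)\in\mathbb{P}$, and if $i>j$ then $f(i)<f(j)$ or $f(i)=f(j)\in-\mathbb{P}$. The $q$-fundamental quasisymmetric function is $L^{(q)}_I=L^{(q)}_{n,I}=\sum_f\prod_{i=1}^n q^{[f(i)<0]}x_{|f(i)|}$ (sum over such $f$, $[f(i)<0]\in\{0,1\}$ indicating negativity) for any $\pi\in S_n$ with $\operatorname{Des}(\pi)=\{i:\pi(i)>\pi(i+1)\}=I$; it depends only on $n$ and $I$. $\operatorname{Peak}(I)=I\setminus(I+1)\setminus\{1\}$ with $I+1=\{i+1:i\in I\}$, and $K-1=\{k-1:k\in K\}$. For $A\subseteq[n-1]$,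 $\eta^{(q)}_A=\sum(q+1)^{|\{i_1,\dots,i_n\}|}x_{i_1}\cdots x_{i_n}$ over $i_1\le\cdots\le i_n$ with $j\in A\Rightarrow i_j=i_{j+1}$. *)

theory Defs
  imports "HOL-Library.Multiset" "HOL-Library.FuncSet" "HOL-Combinatorics.Permutations"
begin

section \<open>Formal power series in arbitrarily many commuting indeterminates\<close>

text \<open>
  A power series is the family of its coefficients, indexed by monomials; the monomial
  \<open>x\<^sub>a x\<^sub>b x\<^sub>c \<cdots>\<close> is the finite multiset \<open>{#a, b, c, \<dots>#}\<close> of indices. Unlike
  polynomials, the family may have infinite support.
\<close>

typedef ('v, 'a) mvfps = "UNIV :: ('v multiset \<Rightarrow> 'a) set"
  morphisms coeff Abs_mvfps
  by simp

lemma coeff_Abs [simp]: "coeff (Abs_mvfps F) = F"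
  by (simp add: Abs_mvfps_inverse)

lemma mvfps_eqI: "(\<And>m. coeff f m = coeff g m) \<Longrightarrow> f = g"
  by (metis coeff_inject ext)

lemma mvfps_eq_iff: "f = g \<longleftrightarrow> (\<forall>m. coeff f m = coeff g m)"
  by (auto intro: mvfps_eqI)

definition splits :: "'v multiset \<Rightarrow> ('v multiset \<times> 'v multiset) set" where
  "splits m = {(a, b). a + b = m}"

lemma finite_submultisets: "finite {a. a \<subseteq># m}"
proof (induction m)
  case empty
  then show ?case by simp
next
  case (add x m)
  have "{a. a \<subseteq># add_mset x m} \<subseteq> {a. a \<subseteq># m} \<union> add_mset x ` {a. a \<subseteq># m}"
  proof
    fix a assume "a \<in> {a. a \<subseteq># add_mset x m}"
    then have a: "a \<subseteq># add_mset x m" by simp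
    show "a \<in> {a. a \<subseteq># m} \<union> add_mset x ` {a. a \<subseteq># m}"
    proof (cases "x \<in># a")
      case True
      then obtain b where "a = add_mset x b" by (meson multi_member_split)
      with a show ?thesis by simp
    next
      case False
      with a have "a \<subseteq># m"
        by (metis diff_single_trivial subset_eq_diff_conv add_mset_add_single)
      then show ?thesis by simp
    qed
  qed
  with add show ?case by (meson finite_UnI finite_imageI finite_subset)
qed

lemma finite_splits [simp]: "finite (splits m)"
proof (rule finite_subset)
  show "splits m \<subseteq> {a. a \<subseteq># m} \<times> {a. a \<subseteq># m}"
    by (auto simp: splits_def)
qed (simp add: finite_submultisets)

lemma splits_empty [simp]: "splits {#} = {({#}, {#})}"
  by (auto simp: splits_def)

instantiation mvfps :: (type, comm_ring_1) comm_ring_1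
begin

definition "0 = Abs_mvfps (\<lambda>_. 0)"
definition "1 = Abs_mvfps (\<lambda>m. if m = {#} then 1 else 0)"
definition "f + g = Abs_mvfps (\<lambda>m. coeff f m + coeff g m)"
definition "- f = Abs_mvfps (\<lambda>m. - coeff f m)"
definition "f - g = Abs_mvfps (\<lambda>m. coeff f m - coeff g m)"
definition "f * g = Abs_mvfps (\<lambda>m. \<Sum>(a, b)\<in>splits m. coeff f a * coeff g b)"

instance
proof
  fix f g h :: "('a, 'b) mvfps"
  show "f * g * h = f * (g * h)"
  proof (rule mvfps_eqI)
    fix m :: "'a multiset"
    let ?A = "SIGMA p:splits m. splits (fst p)" and ?B = "SIGMA p:splits m. splits (snd p)"
    have "coeff (f * g * h) m =
        (\<Sum>p\<in>splits m. \<Sum>r\<in>splits (fst p). coeff f (fst r) * coeff g (snd r) * coeff h (snd p))"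
      by (simp add: times_mvfps_def case_prod_unfold sum_distrib_right)
    also have "\<dots> = (\<Sum>(p, r)\<in>?A. coeff f (fst r) * coeff g (snd r) * coeff h (snd p))"
      by (subst sum.Sigma) auto
    also have "\<dots> = (\<Sum>(p, r)\<in>?B. coeff f (fst p) * (coeff g (fst r) * coeff h (snd r)))"
      by (rule sum.reindex_bij_witness[where
            i = "\<lambda>((a, _), (b, c)). ((a + b, c), (a, b))" and
            j = "\<lambda>((_, c), (a, b)). ((a, b + c), (b, c))"])
         (auto simp: splits_def add.assoc mult.assoc)
    also have "\<dots> = (\<Sum>p\<in>splits m. \<Sum>r\<in>splits (snd p).
        coeff f (fst p) * (coeff g (fst r) * coeff h (snd r)))"
      by (subst sum.Sigma) auto
    also have "\<dots> = coeff (f * (g * h)) m"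
      by (simp add: times_mvfps_def case_prod_unfold sum_distrib_left)
    finally show "coeff (f * g * h) m = coeff (f * (g * h)) m" .
  qed
  show "f * g = g * f"
  proof (rule mvfps_eqI)
    fix m
    show "coeff (f * g) m = coeff (g * f) m"
      unfolding times_mvfps_def coeff_Abs
      by (rule sum.reindex_bij_witness[where i = prod.swap and j = prod.swap])
         (auto simp: splits_def add.commute mult.commute)
  qed
  show "1 * f = f"
  proof (rule mvfps_eqI)
    fix m
    have "coeff (1 * f) m = (\<Sum>p\<in>splits m. if p = ({#}, m) then coeff f m else 0)"
      unfolding times_mvfps_def one_mvfps_def coeff_Abs
      by (rule sum.cong) (auto simp: splits_def split: if_splits)
    also have "\<dots> = coeff f m"
      by (subst sum.delta, rule finite_splits, auto simp: splits_def)
    finally show "coeff (1 * f) m = coeff f m" .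
  qed
  show "(f + g) * h = f * h + g * h"
    by (rule mvfps_eqI)
       (simp add: times_mvfps_def plus_mvfps_def case_prod_unfold algebra_simps sum.distrib)
  show "(0 :: ('a, 'b) mvfps) \<noteq> 1"
    by (auto simp: zero_mvfps_def one_mvfps_def mvfps_eq_iff)
qed (auto intro!: mvfps_eqI simp: zero_mvfps_def plus_mvfps_def uminus_mvfps_def
      minus_mvfps_def algebra_simps)

end

definition const :: "'a \<Rightarrow> ('v, 'a::comm_ring_1) mvfps" where
  "const c = Abs_mvfps (\<lambda>m. if m = {#} then c else 0)"

definition var :: "'v \<Rightarrow> ('v, 'a::comm_ring_1) mvfps" where
  "var i = Abs_mvfps (\<lambda>m. if m = {#i#} then 1 else 0)"

text \<open>
  The sum of a possibly infinite family of power series, taken coefficientwise. It is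
  meaningful for summable families, i.e. when for every monomial all but finitely many
  members have a zero coefficient there (a non-summable coefficient is sent to \<open>0\<close>). The
  families used below are summable, see \<open>summable_qfundamental\<close> and \<open>summable_eta\<close>.
\<close>

definition summable_fam :: "('i \<Rightarrow> ('v, 'a::comm_ring_1) mvfps) \<Rightarrow> 'i set \<Rightarrow> bool" where
  "summable_fam F S \<longleftrightarrow> (\<forall>m. finite {s \<in> S. coeff (F s) m \<noteq> 0})"

definition fam_sum :: "('i \<Rightarrow> ('v, 'a::comm_ring_1) mvfps) \<Rightarrow> 'i set \<Rightarrow> ('v, 'a) mvfps" where
  "fam_sum F S = Abs_mvfps (\<lambda>m. \<Sum>s | s \<in> S \<and> coeff (F s) m \<noteq> 0. coeff (F s) m)"


section \<open>Enriched P-partitions and the q-fundamental quasisymmetric functions\<close>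

text \<open>
  The letters \<open>-1 < 1 < -2 < 2 < \<cdots>\<close> are represented by the nonzero integers, with the
  nonstandard strict order \<open>letter_less\<close>.
\<close>

definition letters :: "int set" where
  "letters = {a. a \<noteq> 0}"

definition letter_less :: "int \<Rightarrow> int \<Rightarrow> bool" where
  "letter_less a b \<longleftrightarrow> \<bar>a\<bar> < \<bar>b\<bar> \<or> (\<bar>a\<bar> = \<bar>b\<bar> \<and> a < b)"

text \<open>The chain on \<open>{1..n}\<close> given by \<open>\<pi> 1 < \<pi> 2 < \<dots> < \<pi> n\<close>.\<close>

definition chain_less :: "nat \<Rightarrow> (nat \<Rightarrow> nat) \<Rightarrow> nat \<Rightarrow> nat \<Rightarrow> bool" where
  "chain_less n \<pi> i j \<longleftrightarrow> (\<exists>a b. 1 \<le> a \<and> a < b \<and> b \<le> n \<and> i = \<pi> a \<and> j = \<pi> b)"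

text \<open>
  Enriched P-partitions for a strict order \<open>R\<close> on \<open>{1..n}\<close>; maps on \<open>{1..n}\<close> are
  extensional functions, so that distinct functions are distinct as maps on \<open>{1..n}\<close>.
\<close>

definition enriched :: "nat \<Rightarrow> (nat \<Rightarrow> nat \<Rightarrow> bool) \<Rightarrow> (nat \<Rightarrow> int) set" where
  "enriched n R = {f \<in> {1..n} \<rightarrow>\<^sub>E letters. \<forall>i\<in>{1..n}. \<forall>j\<in>{1..n}. R i j \<longrightarrow>
     (i < j \<longrightarrow> letter_less (f i) (f j) \<or> (f i = f j \<and> f i > 0)) \<and>
     (i > j \<longrightarrow> letter_less (f i) (f j) \<or> (f i = f j \<and> f i < 0))}"

definition Des :: "nat \<Rightarrow> (nat \<Rightarrow> nat) \<Rightarrow> nat set" where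
  "Des n \<pi> = {i \<in> {1..n-1}. \<pi> i > \<pi> (i + 1)}"

text \<open>
  The indeterminate \<open>x\<^sub>i\<close> is \<open>var i\<close> for \<open>i \<ge> 1\<close>; the extra indeterminate \<open>var 0\<close> never occurs.
\<close>

definition qweight :: "'a::comm_ring_1 \<Rightarrow> nat \<Rightarrow> (nat \<Rightarrow> int) \<Rightarrow> (nat, 'a) mvfps" where
  "qweight q n f = (\<Prod>i\<in>{1..n}. const (q ^ of_bool (f i < 0)) * var (nat \<bar>f i\<bar>))"

definition qfundamental_perm :: "'a::comm_ring_1 \<Rightarrow> nat \<Rightarrow> (nat \<Rightarrow> nat) \<Rightarrow> (nat, 'a) mvfps" where
  "qfundamental_perm q n \<pi> = fam_sum (qweight q n) (enriched n (chain_less n \<pi>))"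

text \<open>
  \<open>L\<^sub>n\<^sub>,\<^sub>I\<close> is defined through an arbitrary permutation with descent set \<open>I\<close>. Such a permutation
  exists (\<open>exists_perm_Des\<close>) and its choice does not matter (\<open>qfundamental_eq\<close>).
\<close>

definition qfundamental :: "'a::comm_ring_1 \<Rightarrow> nat \<Rightarrow> nat set \<Rightarrow> (nat, 'a) mvfps" where
  "qfundamental q n I = qfundamental_perm q n (SOME \<pi>. \<pi> permutes {1..n} \<and> Des n \<pi> = I)"

definition Peak :: "nat set \<Rightarrow> nat set" where
  "Peak I = I - (\<lambda>i. i + 1) ` I - {1}"

definition eta_index :: "nat \<Rightarrow> nat set \<Rightarrow> (nat \<Rightarrow> nat) set" where
  "eta_index n A = {g \<in> {1..n} \<rightarrow>\<^sub>E {1..}.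
     (\<forall>j\<in>{1..n}. \<forall>k\<in>{1..n}. j \<le> k \<longrightarrow> g j \<le> g k) \<and> (\<forall>j\<in>A. g j = g (j + 1))}"

definition eta :: "'a::comm_ring_1 \<Rightarrow> nat \<Rightarrow> nat set \<Rightarrow> (nat, 'a) mvfps" where
  "eta q n A = fam_sum (\<lambda>g. const ((q + 1) ^ card (g ` {1..n})) * (\<Prod>j\<in>{1..n}. var (g j)))
     (eta_index n A)"


section \<open>Well-definedness\<close>

lemma coeff_const_times: "coeff (const c * f) m = c * coeff f m"
proof -
  have "coeff (const c * f) m = (\<Sum>p\<in>splits m. if p = ({#}, m) then c * coeff f m else 0)"
    unfolding times_mvfps_def const_def coeff_Abs
    by (rule sum.cong) (auto simp: splits_def split: if_splits)
  also have "\<dots> = c * coeff f m"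
    by (subst sum.delta, rule finite_splits, auto simp: splits_def)
  finally show ?thesis .
qed

lemma const_mult: "const (c * d) = const c * const d"
  by (rule mvfps_eqI) (simp add: coeff_const_times, simp add: const_def)

lemma const_one: "const 1 = 1"
  by (simp add: const_def one_mvfps_def)

lemma const_prod: "const (\<Prod>i\<in>A. c i) = (\<Prod>i\<in>A. const (c i))"
  by (induction A rule: infinite_finite_induct) (simp_all add: const_mult const_one)

lemma coeff_var_times:
  "coeff (var i * f) m = (if i \<in># m then coeff f (m - {#i#}) else 0)"
proof (cases "i \<in># m")
  case True
  have "coeff (var i * f) m =
      (\<Sum>p\<in>splits m. if p = ({#i#}, m - {#i#}) then coeff f (m - {#i#}) else 0)"
    unfolding times_mvfps_def var_def coeff_Abs
    by (rule sum.cong) (auto simp: splits_def split: if_splits)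
  also have "\<dots> = coeff f (m - {#i#})"
    by (subst sum.delta, rule finite_splits) (use True in \<open>auto simp: splits_def\<close>)
  finally show ?thesis using True by simp
next
  case False
  have "coeff (var i * f) m = (\<Sum>p\<in>splits m. 0)"
    unfolding times_mvfps_def var_def coeff_Abs
    by (rule sum.cong) (use False in \<open>auto simp: splits_def\<close>)
  with False show ?thesis by simp
qed

lemma coeff_prod_var:
  assumes "finite A"
  shows "coeff (\<Prod>i\<in>A. var (g i)) m = (if m = image_mset g (mset_set A) then 1 else 0)"
  using assms
proof (induction A arbitrary: m rule: finite_induct)
  case empty
  then show ?case by (simp add: one_mvfps_def)
next
  case (insert x A)
  then show ?case
    by (auto simp: coeff_var_times dest!: multi_member_split)
qed

lemma coeff_qweight:
  "coeff (qweight q n f) m =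
     (if m = image_mset (\<lambda>i. nat \<bar>f i\<bar>) (mset_set {1..n})
      then \<Prod>i\<in>{1..n}. q ^ of_bool (f i < 0) else 0)"
proof -
  have "qweight q n f =
      const (\<Prod>i\<in>{1..n}. q ^ of_bool (f i < 0)) * (\<Prod>i\<in>{1..n}. var (nat \<bar>f i\<bar>))"
    by (simp add: qweight_def prod.distrib const_prod)
  then show ?thesis by (simp add: coeff_const_times coeff_prod_var)
qed

lemma summable_qfundamental: "summable_fam (qweight q n) (enriched n R)"
  unfolding summable_fam_def
proof
  fix m :: "nat multiset"
  let ?B = "int ` set_mset m \<union> (\<lambda>k. - int k) ` set_mset m"
  have "{f \<in> enriched n R. coeff (qweight q n f) m \<noteq> 0} \<subseteq> {1..n} \<rightarrow>\<^sub>E ?B"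
  proof
    fix f assume f: "f \<in> {f \<in> enriched n R. coeff (qweight q n f) m \<noteq> 0}"
    then have m: "m = image_mset (\<lambda>i. nat \<bar>f i\<bar>) (mset_set {1..n})"
      by (auto simp: coeff_qweight split: if_splits)
    have "f i \<in> ?B" if "i \<in> {1..n}" for i
    proof -
      have "nat \<bar>f i\<bar> \<in># m" using that by (simp add: m)
      moreover have "f i = int (nat \<bar>f i\<bar>) \<or> f i = - int (nat \<bar>f i\<bar>)" by auto
      ultimately show ?thesis by blast
    qed
    moreover have "f \<in> extensional {1..n}"
      using f by (auto simp: enriched_def PiE_def)
    ultimately show "f \<in> {1..n} \<rightarrow>\<^sub>E ?B" by (simp add: PiE_def)
  qed
  then show "finite {f \<in> enriched n R. coeff (qweight q n f) m \<noteq> 0}"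
    by (rule finite_subset) (intro finite_PiE; simp)
qed

lemma summable_eta:
  "summable_fam (\<lambda>g. const (c g) * (\<Prod>j\<in>{1..n}. var (g j))) (eta_index n A)"
  unfolding summable_fam_def
proof
  fix m :: "nat multiset"
  let ?S = "{g \<in> eta_index n A. coeff (const (c g) * (\<Prod>j\<in>{1..n}. var (g j))) m \<noteq> 0}"
  have "?S \<subseteq> {1..n} \<rightarrow>\<^sub>E set_mset m"
  proof
    fix g assume g: "g \<in> ?S"
    then have m: "m = image_mset g (mset_set {1..n})"
      by (auto simp: coeff_const_times coeff_prod_var split: if_splits)
    have "g i \<in># m" if "i \<in> {1..n}" for i using that by (simp add: m)
    moreover have "g \<in> extensional {1..n}"
      using g by (auto simp: eta_index_def PiE_def)
    ultimately show "g \<in> {1..n} \<rightarrow>\<^sub>E set_mset m" by (simp add: PiE_def)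
  qed
  then show "finite ?S"
    by (rule finite_subset) (intro finite_PiE; simp)
qed

lemma exists_perm_Des:
  assumes "I \<subseteq> {1..n-1}"
  shows "\<exists>\<pi>. \<pi> permutes {1..n} \<and> Des n \<pi> = I"
  using assms
proof (induction n arbitrary: I)
  case 0
  then show ?case by (intro exI[of _ id]) (auto simp: Des_def permutes_id)
next
  case (Suc n)
  have "I - {n} \<subseteq> {1..n-1}" using Suc.prems by force
  then obtain p where p: "p permutes {1..n}" and D: "Des n p = I - {n}"
    using Suc.IH by blast
  have pn: "p i \<in> {1..n}" if "i \<in> {1..n}" for i
    using permutes_in_image[OF p] that by blast
  have pinj: "inj_on p {1..n}" using p by (meson permutes_inj_on)
  have Dp: "i \<in> I \<longleftrightarrow> p (i + 1) < p i" if "1 \<le> i" "i < n" for i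
  proof -
    have "i \<in> Des n p \<longleftrightarrow> i \<in> I - {n}" using D by blast
    with that show ?thesis unfolding Des_def by force
  qed
  show ?case
  proof (cases "n \<in> I")
    case True
    define r where "r = (\<lambda>i. if i = Suc n then 1 else if i \<in> {1..n} then p i + 1 else i)"
    have "r k \<in> {1..Suc n}" if "k \<in> {1..Suc n}" for k
      using that pn[of k] by (cases "k = Suc n") (auto simp: r_def)
    then have "r ` {1..Suc n} \<subseteq> {1..Suc n}" by blast
    moreover have inj: "inj_on r {1..Suc n}"
    proof (rule inj_onI)
      fix i j assume i: "i \<in> {1..Suc n}" and j: "j \<in> {1..Suc n}" and eq: "r i = r j"
      have top: "r k = 1 \<longleftrightarrow> k = Suc n" if "k \<in> {1..Suc n}" for k
      proof (cases "k = Suc n")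
        case False
        with that have "k \<in> {1..n}" by auto
        with pn[of k] show ?thesis by (simp add: r_def)
      qed (simp add: r_def)
      show "i = j"
      proof (cases "i = Suc n \<or> j = Suc n")
        case True
        then show ?thesis using top[OF i] top[OF j] eq by metis
      next
        case False
        then have ij: "i \<in> {1..n}" "j \<in> {1..n}" using i j by auto
        with eq have "p i = p j" by (auto simp: r_def split: if_splits)
        with pinj ij show ?thesis by (meson inj_onD)
      qed
    qed
    ultimately have "bij_betw r {1..Suc n} {1..Suc n}"
      by (simp add: bij_betw_def endo_inj_surj)
    then have "r permutes {1..Suc n}"
      by (rule bij_imp_permutes) (auto simp: r_def)
    moreover have "Des (Suc n) r = I"
    proof (rule set_eqI)
      fix i
      have n: "n \<ge> 1" using True Suc.prems by auto
      consider "i = n" | "1 \<le> i" "i < n" | "i = 0 \<or> i > n" by linarith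
      then show "i \<in> Des (Suc n) r \<longleftrightarrow> i \<in> I"
      proof cases
        case 1
        with True n pn[of n] show ?thesis by (auto simp: Des_def r_def)
      next
        case 2
        then show ?thesis using Dp[of i] by (auto simp: Des_def r_def)
      next
        case 3
        then show ?thesis using Suc.prems by (auto simp: Des_def)
      qed
    qed
    ultimately show ?thesis by blast
  next
    case False
    have pfix: "p (Suc n) = Suc n" using p by (simp add: permutes_def)
    have "p permutes {1..Suc n}" using p by (rule permutes_subset) auto
    moreover have "Des (Suc n) p = I"
    proof (rule set_eqI)
      fix i
      consider "i = n" | "1 \<le> i" "i < n" | "i = 0 \<or> i > n" by linarith
      then show "i \<in> Des (Suc n) p \<longleftrightarrow> i \<in> I"
      proof cases
        case 1
        with False pfix pn[of n] show ?thesis by (auto simp: Des_def)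
      next
        case 2
        then show ?thesis using Dp[of i] by (auto simp: Des_def)
      next
        case 3
        then show ?thesis using Suc.prems by (auto simp: Des_def)
      qed
    qed
    ultimately show ?thesis by blast
  qed
qed

text \<open>
  Reading \<open>f\<close> along the chain turns enriched P-partitions into words constrained by the
  descent set alone, which gives independence of the chosen permutation.
\<close>

definition qwords :: "nat \<Rightarrow> nat set \<Rightarrow> (nat \<Rightarrow> int) set" where
  "qwords n D = {g \<in> {1..n} \<rightarrow>\<^sub>E letters. \<forall>i\<in>{1..n-1}. letter_less (g i) (g (i + 1)) \<or>
     (g i = g (i + 1) \<and> (if i \<in> D then g i < 0 else g i > 0))}"

lemma letter_less_trans: "letter_less a b \<Longrightarrow> letter_less b c \<Longrightarrow> letter_less a c"
  unfolding letter_less_def by linarith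

lemma fam_sum_reindex:
  assumes h: "bij_betw h S T" and eq: "\<And>s. s \<in> S \<Longrightarrow> F s = G (h s)"
  shows "fam_sum F S = fam_sum G T"
proof (rule mvfps_eqI)
  fix m
  have "bij_betw h {s \<in> S. coeff (F s) m \<noteq> 0} {t \<in> T. coeff (G t) m \<noteq> 0}"
    using h eq by (auto simp: bij_betw_def inj_on_def)
  then have "(\<Sum>s | s \<in> S \<and> coeff (F s) m \<noteq> 0. coeff (G (h s)) m) =
      (\<Sum>t | t \<in> T \<and> coeff (G t) m \<noteq> 0. coeff (G t) m)"
    by (rule sum.reindex_bij_betw)
  then show "coeff (fam_sum F S) m = coeff (fam_sum G T) m"
    by (simp add: fam_sum_def eq cong: conj_cong)
qed

lemma enriched_iff_qwords:
  assumes p: "\<pi> permutes {1..n}"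
  shows "f \<in> enriched n (chain_less n \<pi>) \<longleftrightarrow> f \<circ> \<pi> \<in> qwords n (Des n \<pi>)"
proof
  have pin: "\<pi> i \<in> {1..n} \<longleftrightarrow> i \<in> {1..n}" for i
    using permutes_in_image[OF p] by blast
  have pinj: "\<pi> i = \<pi> j \<longleftrightarrow> i = j" for i j
    using permutes_inj[OF p] by (auto simp: inj_def)
  {
    assume f: "f \<in> enriched n (chain_less n \<pi>)"
    then have "f \<circ> \<pi> \<in> {1..n} \<rightarrow>\<^sub>E letters"
      unfolding enriched_def PiE_def Pi_def extensional_def using pin by auto
    moreover have "letter_less (f (\<pi> i)) (f (\<pi> (i + 1))) \<or>
        (f (\<pi> i) = f (\<pi> (i + 1)) \<and>
          (if i \<in> Des n \<pi> then f (\<pi> i) < 0 else f (\<pi> i) > 0))"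
      if i: "i \<in> {1..n-1}" for i
    proof -
      have R: "chain_less n \<pi> (\<pi> i) (\<pi> (i + 1))"
        using i unfolding chain_less_def by (intro exI[of _ i] exI[of _ "i + 1"]) auto
      have mem: "\<pi> i \<in> {1..n}" "\<pi> (i + 1) \<in> {1..n}" using i by (auto simp only: pin) auto
      have E: "(x < y \<longrightarrow> letter_less (f x) (f y) \<or> (f x = f y \<and> f x > 0)) \<and>
          (x > y \<longrightarrow> letter_less (f x) (f y) \<or> (f x = f y \<and> f x < 0))"
        if "x \<in> {1..n}" "y \<in> {1..n}" "chain_less n \<pi> x y" for x y
        using f that unfolding enriched_def by blast
      have "\<pi> i < \<pi> (i + 1) \<or> \<pi> (i + 1) < \<pi> i"
        using pinj[of i "i + 1"] by linarith
      moreover have "i \<in> Des n \<pi> \<longleftrightarrow> \<pi> i > \<pi> (i + 1)" using i by (simp add: Des_def)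
      ultimately show ?thesis
        using E[OF mem R] by auto
    qed
    ultimately show "f \<circ> \<pi> \<in> qwords n (Des n \<pi>)" unfolding qwords_def comp_def by blast
  }
  {
    assume g: "f \<circ> \<pi> \<in> qwords n (Des n \<pi>)"
    have "f x \<in> letters" if "x \<in> {1..n}" for x
    proof -
      have "(f \<circ> \<pi>) (inv \<pi> x) \<in> letters"
        using g that permutes_in_image[OF permutes_inv[OF p]] unfolding qwords_def by blast
      then show ?thesis by (simp add: permutes_inverses[OF p])
    qed
    moreover have "f x = undefined" if "x \<notin> {1..n}" for x
    proof -
      have "(f \<circ> \<pi>) x = undefined"
        using g that unfolding qwords_def PiE_def extensional_def by blast
      then show ?thesis using that p by (simp add: permutes_def)
    qed
    ultimately have 1: "f \<in> {1..n} \<rightarrow>\<^sub>E letters" by (auto simp: PiE_def extensional_def)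
    have 2: "letter_less (f (\<pi> a)) (f (\<pi> b)) \<or> (f (\<pi> a) = f (\<pi> b) \<and>
        (\<pi> a < \<pi> b \<longrightarrow> f (\<pi> a) > 0) \<and> (\<pi> a > \<pi> b \<longrightarrow> f (\<pi> a) < 0))"
      if "1 \<le> a" "a < b" "b \<le> n" for a b
      using that(2,3)
    proof (induction b)
      case (Suc b)
      have b: "b \<in> {1..n-1}" using Suc.prems \<open>1 \<le> a\<close> by auto
      then have D: "b \<in> Des n \<pi> \<longleftrightarrow> \<pi> b > \<pi> (Suc b)" by (simp add: Des_def)
      have step: "letter_less (f (\<pi> b)) (f (\<pi> (Suc b))) \<or> (f (\<pi> b) = f (\<pi> (Suc b)) \<and>
          (if \<pi> b > \<pi> (Suc b) then f (\<pi> b) < 0 else f (\<pi> b) > 0))"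
        using g b D unfolding qwords_def by auto
      show ?case
      proof (cases "a = b")
        case True
        with step show ?thesis by (auto split: if_splits)
      next
        case False
        then have IH: "letter_less (f (\<pi> a)) (f (\<pi> b)) \<or> (f (\<pi> a) = f (\<pi> b) \<and>
            (\<pi> a < \<pi> b \<longrightarrow> f (\<pi> a) > 0) \<and> (\<pi> a > \<pi> b \<longrightarrow> f (\<pi> a) < 0))"
          using Suc by simp
        have "\<pi> a \<noteq> \<pi> b" using False by (simp add: pinj)
        with IH step show ?thesis
          using letter_less_trans[of "f (\<pi> a)" "f (\<pi> b)" "f (\<pi> (Suc b))"]
          by (auto split: if_splits)
      qed
    qed simp
    show "f \<in> enriched n (chain_less n \<pi>)"
      using 1 2 unfolding enriched_def chain_less_def by blast
  }
qed

lemma qfundamental_perm_eq: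
  assumes p: "\<pi> permutes {1..n}"
  shows "qfundamental_perm q n \<pi> = fam_sum (qweight q n) (qwords n (Des n \<pi>))"
  unfolding qfundamental_perm_def
proof (rule fam_sum_reindex)
  show "bij_betw (\<lambda>f. f \<circ> \<pi>) (enriched n (chain_less n \<pi>)) (qwords n (Des n \<pi>))"
  proof (rule bij_betw_byWitness[where f' = "\<lambda>g. g \<circ> inv \<pi>"])
    have inv: "g \<circ> inv \<pi> \<circ> \<pi> = g" for g :: "nat \<Rightarrow> int"
      by (simp add: fun_eq_iff permutes_inverses[OF p])
    show "(\<lambda>g. g \<circ> inv \<pi>) ` qwords n (Des n \<pi>) \<subseteq> enriched n (chain_less n \<pi>)"
      by (auto simp: enriched_iff_qwords[OF p] inv)
    show "\<forall>g\<in>qwords n (Des n \<pi>). g \<circ> inv \<pi> \<circ> \<pi> = g" by (simp add: inv)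
  qed (auto simp: enriched_iff_qwords[OF p] fun_eq_iff permutes_inverses[OF p])
  show "qweight q n f = qweight q n (f \<circ> \<pi>)" for f
    unfolding qweight_def by (subst prod.permute[OF p]) (simp add: comp_def)
qed

lemma qfundamental_eq:
  assumes p: "\<pi> permutes {1..n}" and D: "Des n \<pi> = I"
  shows "qfundamental q n I = qfundamental_perm q n \<pi>"
proof -
  define \<sigma> where "\<sigma> = (SOME \<pi>. \<pi> permutes {1..n} \<and> Des n \<pi> = I)"
  have "\<sigma> permutes {1..n} \<and> Des n \<sigma> = I"
    unfolding \<sigma>_def by (rule someI[where x = \<pi>]) (use p D in blast)
  then have "qfundamental_perm q n \<sigma> = qfundamental_perm q n \<pi>"
    using qfundamental_perm_eq[of \<sigma> n q] qfundamental_perm_eq[OF p, of q] D by metis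
  then show ?thesis by (simp add: qfundamental_def \<sigma>_def)
qed

end

theory Submission
  imports Defs
begin

text \<open>
  Compare the coefficients of a monomial. A word contributing to the left-hand side consists of a
  weakly increasing sequence \<open>g\<close> of absolute values and a set \<open>N\<close> of negative positions. If \<open>E\<close> is
  the set of \<open>j\<close> with \<open>g j = g (j + 1)\<close>, the admissible \<open>N\<close> are those that contain \<open>I \<inter> E\<close> and avoid
  \<open>(E - I) + 1\<close>, so they contribute \<open>q ^ |I \<inter> E| * (q + 1) ^ (n - |E|)\<close> if these two sets are disjoint,
  and nothing otherwise. Here \<open>n - |E|\<close> is the number of values of \<open>g\<close>, and disjointness means that
  no peak \<open>k\<close> of \<open>I\<close> satisfies \<open>k, k - 1 \<in> E\<close>. On the right-hand side, \<open>g\<close> selects the pairs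
  \<open>(J, K)\<close> with \<open>J \<union> (K - 1) \<union> K \<subseteq> E\<close>. Their coefficients sum to a product over \<open>I \<inter> E\<close>, with
  factor \<open>1 + (q - 1) - q = 0\<close> at such a peak and \<open>1 + (q - 1) = q\<close> elsewhere.
\<close>

section \<open>Plateaus and admissible sets of negative positions\<close>

definition plateaus :: "nat \<Rightarrow> (nat \<Rightarrow> nat) \<Rightarrow> nat set" where
  "plateaus n g = {j \<in> {1..n-1}. g j = g (j + 1)}"

lemma plateaus_subset: "plateaus n g \<subseteq> {1..n-1}"
  by (auto simp: plateaus_def)

text \<open>Meant for \<open>E = plateaus n g\<close>. A plateau \<open>j \<in> I\<close> forces a
  negative letter at \<open>j\<close>, a plateau \<open>j \<notin> I\<close> a positive letter at
  \<open>Suc j\<close>; hence only \<open>E - I\<close> is shifted.\<close>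

definition neg_sets :: "nat \<Rightarrow> nat set \<Rightarrow> nat set \<Rightarrow> nat set set" where
  "neg_sets n I E = {N. I \<inter> E \<subseteq> N \<and> N \<subseteq> {1..n} - Suc ` (E - I)}"

section \<open>Power sums over families of subsets\<close>

lemma sum_power_card_Pow:
  fixes c :: "'a::comm_ring_1"
  assumes "finite A"
  shows "(\<Sum>X\<in>Pow A. c ^ card X) = (c + 1) ^ card A"
  using prod_add[OF assms, of "\<lambda>_. c" "\<lambda>_. 1"] by simp

text \<open>The elements of \<open>A\<close> are forced; those of \<open>B - A\<close> are free and
  each gives a factor \<open>c + 1\<close>.\<close>

lemma sum_power_card_interval:
  fixes c :: "'a::comm_ring_1"
  assumes "finite B" "A \<subseteq> B"
  shows "(\<Sum>X | A \<subseteq> X \<and> X \<subseteq> B. c ^ card X) = c ^ card A * (c + 1) ^ (card B - card A)"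
proof -
  have A: "finite A" using assms finite_subset by blast
  have "(\<Sum>X | A \<subseteq> X \<and> X \<subseteq> B. c ^ card X) = (\<Sum>Y\<in>Pow (B - A). c ^ card A * c ^ card Y)"
  proof (rule sum.reindex_bij_witness[where i = "\<lambda>Y. A \<union> Y" and j = "\<lambda>X. X - A"])
    fix X assume X: "X \<in> {X. A \<subseteq> X \<and> X \<subseteq> B}"
    then have "finite X" using assms finite_subset by blast
    with X have "card X = card A + card (X - A)"
      using A by (metis card_mono card_Diff_subset le_add_diff_inverse mem_Collect_eq)
    then show "c ^ card A * c ^ card (X - A) = c ^ card X" by (simp add: power_add)
  qed (use assms in auto)
  also have "\<dots> = c ^ card A * (c + 1) ^ (card B - card A)"
    using assms A by (simp add: sum_distrib_left[symmetric] sum_power_card_Pow card_Diff_subset)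
  finally show ?thesis .
qed

text \<open>If \<open>k\<close> is a peak with \<open>k\<close> and \<open>k - 1\<close> in
  \<open>E\<close>, then \<open>k - 1 \<notin> I\<close>, so position \<open>k\<close> is both
  forced into \<open>N\<close> and excluded from it. Without such a peak, the forced and the
  excluded positions are disjoint and number \<open>card E\<close> together.\<close>

lemma sum_neg_sets:
  fixes q :: "'a::comm_ring_1"
  assumes E: "E \<subseteq> {1..n-1}"
  shows "(\<Sum>N\<in>neg_sets n I E. q ^ card N) =
    (if \<exists>k\<in>Peak I. k \<in> E \<and> k - 1 \<in> E then 0
     else q ^ card (I \<inter> E) * (q + 1) ^ (n - card E))"
proof -
  have fin: "finite E" using E finite_subset by blast
  have peak: "(\<exists>k\<in>Peak I. k \<in> E \<and> k - 1 \<in> E) \<longleftrightarrow> I \<inter> E \<inter> Suc ` (E - I) \<noteq> {}"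
    (is "?L \<longleftrightarrow> ?R")
  proof
    assume ?L
    then obtain k where k: "k \<in> I" "k \<notin> (\<lambda>i. i + 1) ` I" "k \<in> E" "k - 1 \<in> E"
      by (auto simp: Peak_def)
    have "k = Suc (k - 1)" using k E by auto
    moreover from this have "k - 1 \<notin> I" using k(2) by (metis Suc_eq_plus1 imageI)
    ultimately show ?R using k by blast
  next
    assume ?R
    then obtain j where j: "j \<in> E" "j \<notin> I" "Suc j \<in> I" "Suc j \<in> E" by auto
    \<comment> \<open>Needed because \<open>Peak\<close> leaves out \<open>1\<close>, so
      \<open>Suc j \<noteq> 1\<close> must be known.\<close>
    have "j \<ge> 1" using j E by auto
    then have "Suc j \<in> Peak I" using j by (auto simp: Peak_def)
    then show ?L using j by auto
  qed
  show ?thesis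
  proof (cases "I \<inter> E \<inter> Suc ` (E - I) = {}")
    case False
    then have "neg_sets n I E = {}" by (auto simp: neg_sets_def)
    then show ?thesis using False peak by simp
  next
    case True
    \<comment> \<open>Since \<open>E\<close> stops at \<open>n - 1\<close>, its shift by one stays
      inside \<open>{1..n}\<close>.\<close>
    have E': "1 \<le> j" "j \<le> n" "Suc j \<le> n" if "j \<in> E" for j using subsetD[OF E that] by auto
    then have cB: "card ({1..n} - Suc ` (E - I)) = n - card (E - I)"
      using fin by (subst card_Diff_subset) (auto simp: card_image)
    have "card E = card (I \<inter> E) + card (E - I)"
      using fin by (metis Int_commute card_Int_Diff)
    then have "card ({1..n} - Suc ` (E - I)) - card (I \<inter> E) = n - card E"
      using cB by simp
    moreover have "(\<Sum>N\<in>neg_sets n I E. q ^ card N) =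
        q ^ card (I \<inter> E) * (q + 1) ^ (card ({1..n} - Suc ` (E - I)) - card (I \<inter> E))"
      unfolding neg_sets_def
      by (rule sum_power_card_interval) (use True E' in auto)
    ultimately show ?thesis using True peak by auto
  qed
qed

text \<open>For fixed \<open>K\<close>, the set \<open>J\<close> runs through all subsets of
  \<open>I \<inter> E - K\<close> and contributes \<open>q ^ card (I \<inter> E - K)\<close>.
  Together with \<open>(-q) ^ card K\<close> this is \<open>q ^ card (I \<inter> E)\<close> up to
  the sign \<open>(-1) ^ card K\<close>, and these signs cancel unless \<open>K\<close> can only be
  empty.\<close>

lemma sum_peak_pairs:
  fixes q :: "'a::comm_ring_1"
  assumes I: "finite I"
  shows "(\<Sum>(J, K) | J \<subseteq> I \<and> K \<subseteq> Peak I \<and> J \<inter> K = {} \<and> J \<union> (\<lambda>k. k - 1) ` K \<union> K \<subseteq> E.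
       (-q) ^ card K * (q - 1) ^ card J) =
    (if \<exists>k\<in>Peak I. k \<in> E \<and> k - 1 \<in> E then 0 else q ^ card (I \<inter> E))"
proof -
  define P where "P = {k \<in> Peak I. k \<in> E \<and> k - 1 \<in> E}"
  have PI: "P \<subseteq> I \<inter> E" by (auto simp: P_def Peak_def)
  then have P: "finite P" using I finite_subset by blast
  have "(\<Sum>(J, K) | J \<subseteq> I \<and> K \<subseteq> Peak I \<and> J \<inter> K = {} \<and> J \<union> (\<lambda>k. k - 1) ` K \<union> K \<subseteq> E.
       (-q) ^ card K * (q - 1) ^ card J) =
      (\<Sum>(K, J)\<in>(SIGMA K:Pow P. Pow (I \<inter> E - K)). (-q) ^ card K * (q - 1) ^ card J)"
    by (rule sum.reindex_bij_witness[where i = prod.swap and j = prod.swap])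
       (auto simp: P_def image_subset_iff)
  also have "\<dots> = (\<Sum>K\<in>Pow P. (-q) ^ card K * (\<Sum>J\<in>Pow (I \<inter> E - K). (q - 1) ^ card J))"
    using I P by (simp add: sum.Sigma[symmetric] sum_distrib_left)
  also have "\<dots> = (\<Sum>K\<in>Pow P. q ^ card (I \<inter> E) * (-1) ^ card K)"
  proof (rule sum.cong)
    fix K assume "K \<in> Pow P"
    then have K: "K \<subseteq> I \<inter> E" using PI by blast
    then have "card (I \<inter> E) = card K + card (I \<inter> E - K)"
      using I by (metis card_Diff_subset card_mono finite_Int finite_subset le_add_diff_inverse)
    moreover have "(\<Sum>J\<in>Pow (I \<inter> E - K). (q - 1) ^ card J) = q ^ card (I \<inter> E - K)"
      using I by (simp add: sum_power_card_Pow)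
    ultimately show "(-q) ^ card K * (\<Sum>J\<in>Pow (I \<inter> E - K). (q - 1) ^ card J) =
        q ^ card (I \<inter> E) * (-1) ^ card K"
      by (simp add: power_add power_minus[of q] mult_ac)
  qed simp
  \<comment> \<open>The alternating sum is \<open>(-1 + 1) ^ card P\<close>; the convention
    \<open>0 ^ 0 = 1\<close> covers empty \<open>P\<close>.\<close>
  also have "\<dots> = q ^ card (I \<inter> E) * 0 ^ card P"
    using P by (simp add: sum_distrib_left[symmetric] sum_power_card_Pow)
  also have "\<dots> = (if P = {} then q ^ card (I \<inter> E) else 0)"
    using P by (simp add: power_0_left)
  finally show ?thesis by (auto simp: P_def)
qed

section \<open>Weakly increasing sequences and their plateaus\<close>

lemma eta_index_iff_step:
  "g \<in> eta_index n {} \<longleftrightarrow>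
    g \<in> {1..n} \<rightarrow>\<^sub>E {1..} \<and> (\<forall>j\<in>{1..n-1}. g j \<le> g (Suc j))"
proof
  assume "g \<in> eta_index n {}"
  then show "g \<in> {1..n} \<rightarrow>\<^sub>E {1..} \<and> (\<forall>j\<in>{1..n-1}. g j \<le> g (Suc j))"
    by (auto simp: eta_index_def)
next
  assume g: "g \<in> {1..n} \<rightarrow>\<^sub>E {1..} \<and> (\<forall>j\<in>{1..n-1}. g j \<le> g (Suc j))"
  have "g j \<le> g k" if "1 \<le> j" "j \<le> k" "k \<le> n" for j k
    using that(2,3)
  proof (induction k rule: dec_induct)
    case (step k)
    then have "g k \<le> g (Suc k)" using g \<open>1 \<le> j\<close> by auto
    with step show ?case by simp
  qed simp
  with g show "g \<in> eta_index n {}" by (auto simp: eta_index_def)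
qed

text \<open>Puts the series \<open>eta q n A\<close> for different \<open>A\<close> over one common
  family of sequences.\<close>

lemma eta_index_eq_plateaus:
  assumes "A \<subseteq> {1..n-1}"
  shows "eta_index n A = {g \<in> eta_index n {}. A \<subseteq> plateaus n g}"
  using assms by (auto simp: eta_index_def plateaus_def)

text \<open>By monotonicity each value fills an interval of positions, of which exactly the last is
  not a plateau. So \<open>g\<close> is injective off its plateaus and still attains all its values
  there.\<close>

lemma card_image_eta_index:
  assumes g: "g \<in> eta_index n {}"
  shows "card (g ` {1..n}) = n - card (plateaus n g)"
proof -
  have mono: "g j \<le> g k" if "1 \<le> j" "j \<le> k" "k \<le> n" for j k
    using g that by (auto simp: eta_index_def)
  have no_rep: "g i < g k" if "i \<in> {1..n} - plateaus n g" "i < k" "k \<le> n" for i k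
  proof -
    have "g i \<noteq> g (i + 1)" using that by (auto simp: plateaus_def)
    moreover have "g i \<le> g (i + 1)" "g (i + 1) \<le> g k" using that by (auto intro: mono)
    ultimately show ?thesis by simp
  qed
  have "inj_on g ({1..n} - plateaus n g)"
  proof (rule inj_onI)
    fix i k assume "i \<in> {1..n} - plateaus n g" "k \<in> {1..n} - plateaus n g" "g i = g k"
    then show "i = k" using no_rep[of i k] no_rep[of k i] by (cases i k rule: linorder_cases) auto
  qed
  moreover have "g ` ({1..n} - plateaus n g) = g ` {1..n}"
  proof (intro equalityI subsetI)
    fix v assume "v \<in> g ` {1..n}"
    then have ne: "{k \<in> {1..n}. g k = v} \<noteq> {}" by auto
    \<comment> \<open>The last occurrence of \<open>v\<close>, which cannot be a plateau.\<close>
    define k where "k = Max {k \<in> {1..n}. g k = v}"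
    have k: "k \<in> {1..n}" "g k = v" using Max_in[OF _ ne] by (auto simp: k_def)
    have "k \<notin> plateaus n g"
    proof
      assume "k \<in> plateaus n g"
      then have "k + 1 \<in> {k \<in> {1..n}. g k = v}" using k by (auto simp: plateaus_def)
      then have "k + 1 \<le> k" unfolding k_def by (intro Max_ge) auto
      then show False by simp
    qed
    then show "v \<in> g ` ({1..n} - plateaus n g)" using k by blast
  qed auto
  moreover have "card ({1..n} - plateaus n g) = n - card (plateaus n g)"
    by (subst card_Diff_subset) (auto simp: plateaus_def)
  ultimately show ?thesis by (metis card_image)
qed

section \<open>Words as pairs of absolute values and negative positions\<close>

definition abs_word :: "nat \<Rightarrow> (nat \<Rightarrow> int) \<Rightarrow> nat \<Rightarrow> nat" where
  "abs_word n f = (\<lambda>i\<in>{1..n}. nat \<bar>f i\<bar>)"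

definition neg_positions :: "nat \<Rightarrow> (nat \<Rightarrow> int) \<Rightarrow> nat set" where
  "neg_positions n f = {i \<in> {1..n}. f i < 0}"

definition signed_word :: "nat \<Rightarrow> (nat \<Rightarrow> nat) \<Rightarrow> nat set \<Rightarrow> nat \<Rightarrow> int" where
  "signed_word n g N = (\<lambda>i\<in>{1..n}. if i \<in> N then - int (g i) else int (g i))"

text \<open>For equal absolute values \<open>k\<close> the pair \<open>(-k, k)\<close> is always
  allowed, besides it \<open>(-k, -k)\<close> if \<open>d\<close> and \<open>(k, k)\<close>
  otherwise. Thus \<open>d\<close> fixes only the first sign, and its negation only the
  second.\<close>

lemma qword_step_iff:
  "letter_less a b \<or> a = b \<and> (if d then a < 0 else a > 0) \<longleftrightarrow>
    nat \<bar>a\<bar> \<le> nat \<bar>b\<bar> \<and> (nat \<bar>a\<bar> = nat \<bar>b\<bar> \<longrightarrow> (if d then a < 0 else b > 0))"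
  if "a \<noteq> 0" "b \<noteq> 0"
proof -
  consider "\<bar>a\<bar> < \<bar>b\<bar>" | "a = b" | "a = - b" | "\<bar>b\<bar> < \<bar>a\<bar>" by linarith
  then show ?thesis
    by cases (use that in \<open>auto simp: letter_less_def\<close>)
qed

text \<open>Absolute values only have to increase weakly, and signs are constrained only at
  plateaus.\<close>

lemma qwords_iff:
  "f \<in> qwords n I \<longleftrightarrow> f \<in> {1..n} \<rightarrow>\<^sub>E letters \<and> abs_word n f \<in> eta_index n {} \<and>
    neg_positions n f \<in> neg_sets n I (plateaus n (abs_word n f))"
proof (cases "f \<in> {1..n} \<rightarrow>\<^sub>E letters")
  case True
  then have nz: "f i \<noteq> 0" if "1 \<le> i" "i \<le> n" for i
    using that by (auto simp: letters_def PiE_def Pi_def)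
  have pos: "abs_word n f \<in> {1..n} \<rightarrow>\<^sub>E {1..}"
    using nz by (force simp: abs_word_def)
  have step: "letter_less (f i) (f (i+1)) \<or> f i = f (i+1) \<and> (if i \<in> I then f i < 0 else f i > 0) \<longleftrightarrow>
      nat \<bar>f i\<bar> \<le> nat \<bar>f (i+1)\<bar> \<and>
      (nat \<bar>f i\<bar> = nat \<bar>f (i+1)\<bar> \<longrightarrow> (if i \<in> I then f i < 0 else f (i+1) > 0))"
    if "i \<in> {1..n-1}" for i
    by (rule qword_step_iff) (use nz that in auto)
  have "f \<in> qwords n I \<longleftrightarrow> (\<forall>i\<in>{1..n-1}. nat \<bar>f i\<bar> \<le> nat \<bar>f (i+1)\<bar> \<and>
      (nat \<bar>f i\<bar> = nat \<bar>f (i+1)\<bar> \<longrightarrow> (if i \<in> I then f i < 0 else f (i+1) > 0)))"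
    by (simp only: qwords_def mem_Collect_eq True simp_thms step cong: ball_cong)
  also have "\<dots> \<longleftrightarrow> (\<forall>i\<in>{1..n-1}. abs_word n f i \<le> abs_word n f (Suc i)) \<and>
      (\<forall>i\<in>plateaus n (abs_word n f). if i \<in> I then f i < 0 else f (Suc i) > 0)"
    by (auto simp: plateaus_def abs_word_def)
  also have "(\<forall>i\<in>plateaus n (abs_word n f). if i \<in> I then f i < 0 else f (Suc i) > 0) \<longleftrightarrow>
      neg_positions n f \<in> neg_sets n I (plateaus n (abs_word n f))"
  proof -
    \<comment> \<open>As letters are nonzero, a positive letter is the same as a position outside
      \<open>neg_positions n f\<close>.\<close>
    have "f (Suc i) > 0 \<longleftrightarrow> \<not> f (Suc i) < 0" if "i \<in> plateaus n (abs_word n f)" for i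
    proof -
      have "f (Suc i) \<noteq> 0" using that by (intro nz) (auto simp: plateaus_def)
      then show ?thesis by linarith
    qed
    moreover have "i \<in> {1..n} \<and> Suc i \<in> {1..n}" if "i \<in> plateaus n (abs_word n f)" for i
      using that by (auto simp: plateaus_def)
    moreover have "N \<in> neg_sets n I E \<longleftrightarrow>
        (\<forall>i\<in>E. (i \<in> I \<longrightarrow> i \<in> N) \<and> (i \<notin> I \<longrightarrow> Suc i \<notin> N))" if "N \<subseteq> {1..n}" for N E
      using that unfolding neg_sets_def by blast
    moreover have "neg_positions n f \<subseteq> {1..n}" by (auto simp: neg_positions_def)
    ultimately show ?thesis by (simp add: neg_positions_def)
  qed
  finally show ?thesis using True pos by (simp add: eta_index_iff_step)
qed (auto simp: qwords_def)

text \<open>The values of \<open>g\<close> are positive, so the sign of each letter records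
  membership in \<open>N\<close>.\<close>

lemma signed_word_inverse:
  assumes g: "g \<in> {1..n} \<rightarrow>\<^sub>E {1..}" and N: "N \<subseteq> {1..n}"
  shows "abs_word n (signed_word n g N) = g" "neg_positions n (signed_word n g N) = N"
    "signed_word n g N \<in> {1..n} \<rightarrow>\<^sub>E letters"
proof -
  have pos: "g i > 0" if "1 \<le> i" "i \<le> n" for i using g that by (force simp: PiE_def Pi_def)
  show "abs_word n (signed_word n g N) = g"
    using g by (auto simp: abs_word_def signed_word_def fun_eq_iff PiE_def extensional_def)
  show "neg_positions n (signed_word n g N) = N"
    using N pos by (auto simp: neg_positions_def signed_word_def split: if_splits)
  show "signed_word n g N \<in> {1..n} \<rightarrow>\<^sub>E letters"
    using pos by (force simp: signed_word_def letters_def)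
qed

lemma signed_abs_word:
  assumes "f \<in> {1..n} \<rightarrow>\<^sub>E letters"
  shows "signed_word n (abs_word n f) (neg_positions n f) = f"
  using assms
  by (auto simp: abs_word_def signed_word_def neg_positions_def fun_eq_iff PiE_def extensional_def)

section \<open>Coefficients of both sides at a monomial\<close>

definition seqs_of_monom :: "nat \<Rightarrow> nat multiset \<Rightarrow> (nat \<Rightarrow> nat) set" where
  "seqs_of_monom n m = {g \<in> eta_index n {}. image_mset g (mset_set {1..n}) = m}"

lemma finite_seqs_of_monom: "finite (seqs_of_monom n m)"
proof (rule finite_subset)
  show "seqs_of_monom n m \<subseteq> {1..n} \<rightarrow>\<^sub>E set_mset m"
    by (auto simp: seqs_of_monom_def eta_index_def)
qed (intro finite_PiE; simp)

lemma finite_neg_sets: "finite (neg_sets n I E)"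
  by (rule finite_subset[of _ "Pow {1..n}"]) (auto simp: neg_sets_def)

text \<open>The support in \<open>fam_sum\<close> depends on which coefficients vanish in the ring;
  any finite set containing it may replace it.\<close>

lemma coeff_fam_sum:
  assumes "finite T" "T \<subseteq> S" "\<And>s. s \<in> S - T \<Longrightarrow> coeff (F s) m = 0"
  shows "coeff (fam_sum F S) m = (\<Sum>s\<in>T. coeff (F s) m)"
  unfolding fam_sum_def coeff_Abs
  by (rule sum.mono_neutral_left) (use assms in auto)

text \<open>A word is its absolute values together with its negative positions, each of which
  contributes a factor \<open>q\<close>. The outer sum has at most one term, the increasing
  arrangement of \<open>m\<close>.\<close>

lemma coeff_qfundamental:
  fixes q :: "'a::comm_ring_1"
  assumes "I \<subseteq> {1..n-1}"
  shows "coeff (qfundamental q n I) m =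
    (\<Sum>g\<in>seqs_of_monom n m. \<Sum>N\<in>neg_sets n I (plateaus n g). q ^ card N)"
proof -
  let ?X = "SIGMA g:seqs_of_monom n m. neg_sets n I (plateaus n g)"
  let ?T = "{f \<in> qwords n I. image_mset (\<lambda>i. nat \<bar>f i\<bar>) (mset_set {1..n}) = m}"
  obtain \<pi> where "\<pi> permutes {1..n}" "Des n \<pi> = I" using exists_perm_Des[OF assms] by blast
  then have L: "qfundamental q n I = fam_sum (qweight q n) (qwords n I)"
    by (simp add: qfundamental_eq qfundamental_perm_eq)
  have abs_mset: "image_mset (\<lambda>i. nat \<bar>f i\<bar>) (mset_set {1..n}) =
      image_mset (abs_word n f) (mset_set {1..n})" for f
    by (rule image_mset_cong) (simp add: abs_word_def)
  have X: "g \<in> {1..n} \<rightarrow>\<^sub>E {1..}" "N \<subseteq> {1..n}" if "(g, N) \<in> ?X" for g N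
    using that by (auto simp: seqs_of_monom_def eta_index_def neg_sets_def)
  have bij: "bij_betw (\<lambda>f. (abs_word n f, neg_positions n f)) ?T ?X"
  proof (rule bij_betw_byWitness[where f' = "\<lambda>(g, N). signed_word n g N"])
    show "\<forall>f\<in>?T. (case (abs_word n f, neg_positions n f) of (g, N) \<Rightarrow> signed_word n g N) = f"
      by (auto simp: qwords_iff signed_abs_word)
    show "\<forall>p\<in>?X. (abs_word n (case p of (g, N) \<Rightarrow> signed_word n g N),
        neg_positions n (case p of (g, N) \<Rightarrow> signed_word n g N)) = p"
    proof
      fix p assume "p \<in> ?X"
      moreover obtain g N where p: "p = (g, N)" by (cases p)
      ultimately have "(g, N) \<in> ?X" by simp
      then show "(abs_word n (case p of (g, N) \<Rightarrow> signed_word n g N),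
          neg_positions n (case p of (g, N) \<Rightarrow> signed_word n g N)) = p"
        by (simp only: p case_prod_conv signed_word_inverse[OF X])
    qed
    show "(\<lambda>f. (abs_word n f, neg_positions n f)) ` ?T \<subseteq> ?X"
      unfolding abs_mset by (auto simp: qwords_iff seqs_of_monom_def)
    show "(\<lambda>(g, N). signed_word n g N) ` ?X \<subseteq> ?T"
    proof clarify
      fix g N assume gN: "g \<in> seqs_of_monom n m" "N \<in> neg_sets n I (plateaus n g)"
      then have "(g, N) \<in> ?X" by simp
      note s = signed_word_inverse[OF X[OF this]]
      show "signed_word n g N \<in> qwords n I \<and>
          image_mset (\<lambda>i. nat \<bar>signed_word n g N i\<bar>) (mset_set {1..n}) = m"
        unfolding qwords_iff abs_mset s(1,2) using s(3) gN by (simp add: seqs_of_monom_def)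
    qed
  qed
  \<comment> \<open>Transported along the bijection, this makes \<open>?T\<close> finite, as
    \<open>coeff_fam_sum\<close> requires.\<close>
  have finX: "finite ?X" by (simp add: finite_seqs_of_monom finite_neg_sets)
  have "coeff (qfundamental q n I) m = (\<Sum>f\<in>?T. coeff (qweight q n f) m)"
    unfolding L
    by (rule coeff_fam_sum) (use bij finX in \<open>auto simp: bij_betw_finite coeff_qweight\<close>)
  also have "\<dots> = (\<Sum>f\<in>?T. q ^ card (neg_positions n f))"
  proof (rule sum.cong)
    fix f assume "f \<in> ?T"
    then have "coeff (qweight q n f) m = (\<Prod>i\<in>{1..n}. q ^ of_bool (f i < 0))"
      by (simp add: coeff_qweight)
    also have "\<dots> = (\<Prod>i\<in>{1..n}. if f i < 0 then q else 1)" by (rule prod.cong) auto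
    also have "\<dots> = q ^ card (neg_positions n f)"
      by (simp add: neg_positions_def prod.inter_filter[symmetric])
    finally show "coeff (qweight q n f) m = q ^ card (neg_positions n f)" .
  qed simp
  also have "\<dots> = (\<Sum>(g, N)\<in>?X. q ^ card N)"
    using sum.reindex_bij_betw[OF bij, of "\<lambda>(g, N). q ^ card N"] by simp
  finally show ?thesis
    by (simp add: sum.Sigma finite_seqs_of_monom finite_neg_sets)
qed

lemma coeff_eta:
  fixes q :: "'a::comm_ring_1"
  assumes "A \<subseteq> {1..n-1}"
  shows "coeff (eta q n A) m = (\<Sum>g\<in>seqs_of_monom n m.
    if A \<subseteq> plateaus n g then (q + 1) ^ (n - card (plateaus n g)) else 0)"
proof -
  let ?T = "{g \<in> seqs_of_monom n m. A \<subseteq> plateaus n g}"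
  let ?F = "\<lambda>g. const ((q + 1) ^ card (g ` {1..n})) * (\<Prod>j\<in>{1..n}. var (g j))"
  have "finite ?T" by (simp add: finite_seqs_of_monom)
  then have "coeff (eta q n A) m = (\<Sum>g\<in>?T. coeff (?F g) m)"
    unfolding eta_def
    by (rule coeff_fam_sum)
       (auto simp: eta_index_eq_plateaus[OF assms] seqs_of_monom_def
          coeff_const_times coeff_prod_var)
  also have "\<dots> = (\<Sum>g\<in>?T. (q + 1) ^ (n - card (plateaus n g)))"
    by (rule sum.cong, simp, subst card_image_eta_index)
       (auto simp: seqs_of_monom_def coeff_const_times coeff_prod_var)
  finally show ?thesis by (simp add: sum.inter_filter finite_seqs_of_monom)
qed

lemma coeff_sum: "coeff (sum F S) m = (\<Sum>s\<in>S. coeff (F s) m)"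
  by (induction S rule: infinite_finite_induct) (simp_all add: zero_mvfps_def plus_mvfps_def)

theorem theorem4p2:
  fixes q :: "'a::comm_ring_1" and n :: nat and I :: "nat set"
  assumes "I \<subseteq> {1..n-1}"
  shows "qfundamental q n I =
    (\<Sum>(J, K) | J \<subseteq> I \<and> K \<subseteq> Peak I \<and> J \<inter> K = {}.
       const ((-q) ^ card K * (q - 1) ^ card J) * eta q n (J \<union> (\<lambda>k. k - 1) ` K \<union> K))"
proof (rule mvfps_eqI)
  fix m
  let ?S = "{(J, K). J \<subseteq> I \<and> K \<subseteq> Peak I \<and> J \<inter> K = {}}"
  let ?A = "\<lambda>p. fst p \<union> (\<lambda>k. k - 1) ` snd p \<union> snd p"
  let ?c = "\<lambda>p. (-q) ^ card (snd p) * (q - 1) ^ card (fst p)"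
  let ?P = "\<lambda>g. plateaus n g"
  have I: "finite I" using assms finite_subset by blast
  have S: "finite ?S"
    by (rule finite_subset[of _ "Pow I \<times> Pow I"]) (use I in \<open>auto simp: Peak_def\<close>)
  have A: "?A p \<subseteq> {1..n-1}" if "p \<in> ?S" for p
  proof -
    \<comment> \<open>A peak is never \<open>1\<close>, so \<open>k - 1\<close> stays at least
      \<open>1\<close>.\<close>
    have "k \<in> {1..n-1} \<and> k - 1 \<in> {1..n-1}" if "k \<in> Peak I" for k
      using that assms by (force simp: Peak_def)
    then show ?thesis using \<open>p \<in> ?S\<close> assms by auto
  qed
  have "coeff (\<Sum>(J, K)\<in>?S. const ((-q) ^ card K * (q - 1) ^ card J) *
        eta q n (J \<union> (\<lambda>k. k - 1) ` K \<union> K)) m = (\<Sum>p\<in>?S. ?c p * coeff (eta q n (?A p)) m)"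
    by (simp add: coeff_sum case_prod_unfold coeff_const_times)
  also have "\<dots> = (\<Sum>p\<in>?S. \<Sum>g\<in>seqs_of_monom n m.
      if ?A p \<subseteq> ?P g then ?c p * (q + 1) ^ (n - card (?P g)) else 0)"
    by (rule sum.cong) (simp_all only: coeff_eta[OF A] sum_distrib_left if_distrib mult_zero_right)
  \<comment> \<open>After the exchange the plateau set is fixed, and the inner sum is the one over
    peak pairs.\<close>
  also have "\<dots> = (\<Sum>g\<in>seqs_of_monom n m. \<Sum>p\<in>?S.
      if ?A p \<subseteq> ?P g then ?c p * (q + 1) ^ (n - card (?P g)) else 0)"
    by (rule sum.swap)
  also have "\<dots> = (\<Sum>g\<in>seqs_of_monom n m. \<Sum>N\<in>neg_sets n I (?P g). q ^ card N)"
  proof (rule sum.cong)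
    fix g
    have "(\<Sum>p\<in>?S. if ?A p \<subseteq> ?P g then ?c p * (q + 1) ^ (n - card (?P g)) else 0) =
        (\<Sum>p | p \<in> ?S \<and> ?A p \<subseteq> ?P g. ?c p) * (q + 1) ^ (n - card (?P g))"
      using S by (simp add: sum.inter_filter[symmetric] sum_distrib_right)
    also have "{p. p \<in> ?S \<and> ?A p \<subseteq> ?P g} =
        {(J, K). J \<subseteq> I \<and> K \<subseteq> Peak I \<and> J \<inter> K = {} \<and> J \<union> (\<lambda>k. k - 1) ` K \<union> K \<subseteq> ?P g}"
      by auto
    also have "(\<Sum>p\<in>\<dots>. ?c p) * (q + 1) ^ (n - card (?P g)) =
        (\<Sum>N\<in>neg_sets n I (?P g). q ^ card N)"
      using sum_peak_pairs[OF I, of q "?P g"]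
      by (auto simp: case_prod_unfold sum_neg_sets[OF plateaus_subset])
    finally show "(\<Sum>p\<in>?S. if ?A p \<subseteq> ?P g then ?c p * (q + 1) ^ (n - card (?P g)) else 0) =
        (\<Sum>N\<in>neg_sets n I (?P g). q ^ card N)" .
  qed simp
  finally show "coeff (qfundamental q n I) m = coeff (\<Sum>(J, K)\<in>?S.
      const ((-q) ^ card K * (q - 1) ^ card J) * eta q n (J \<union> (\<lambda>k. k - 1) ` K \<union> K)) m"
    by (simp add: coeff_qfundamental[OF assms])
qed

end
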